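(* Let $(N,\cdot,\circ)$ be a nonzero $2$-dimensional Novikov--Poisson algebra over $\mathbb C$. Then $N$ is isomorphic to one of the following algebras with basis $e_1,e_2$ (where $\alpha,\beta,\gamma\in\mathbb C$). (a) Algebras with zero product $\cdot$: $N_{01}: e_1\circ e_1=e_2$; $N_{02}: e_2\circ e_1=-e_1$; $N_{03}: e_1\circ e_1=e_1,\ e_2\circ e_2=e_2$; $N_{04}: e_1\circ e_1=e_1$; $N_{05}: e_1\circ e_2=e_1,\ e_2\circ e_2=e_1+e_2$; $N_{06}^{\gamma}: e_1\circ e_2=e_1,\ e_2\circ e_1=\gamma e_1,\ e_2\circ e_2=e_2$. (b) Algebras with nonzero product $\cdot$: $N_{07}^{\alpha,\beta}: e_1\cdot e_1=e_1,\ e_2\cdot e_2=e_2,\ e_1\circ e_1=\alpha e_1,\ e_2\circ e_2=\beta e_2$; $N_{08}^{\alpha,\beta}: e_1\cdot e_1=e_1,\ e_1\cdot e_2=e_2,\ e_1\circ e_1=\alpha e_1+e_2,\ e_1\circ e_2=\beta e_2,\ e_2\circ e_1=\alpha e_2$; $N_{09}^{\alpha,\beta}: e_1\cdot e_1=e_1,\ e_1\cdot e_2=e_2,\ e_1\circ e_1=\alpha e_1,\ e_1\circ e_2=\beta e_2,\ e_2\circ e_1=\alpha e_2$; $N_{10}^{\alpha}: e_1\cdot e_1=e_1,\ e_1\circ e_1=\alpha e_1,\ e_2\circ e_2=e_2$; $N_{11}^{\alpha}: e_1\cdot e_1=e_1,\ e_1\circ e_1=\alpha e_1$; $N_{12}^{\alpha}: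 e_1\cdot e_1=e_2,\ e_1\circ e_1=\alpha e_1,\ e_1\circ e_2=e_2,\ e_2\circ e_1=\alpha e_2$; $N_{13}^{\alpha}: e_1\cdot e_1=e_2,\ e_1\circ e_1=e_1+\alpha e_2,\ e_2\circ e_1=e_2$; $N_{14}^{\alpha}: e_1\cdot e_1=e_2,\ e_1\circ e_1=\alpha e_2$. The only non-trivial isomorphisms between the algebras in (b) are $N_{07}^{\alpha,\beta}\cong N_{07}^{\beta,\alpha}$.
   Context: A Novikov--Poisson algebra is a complex vector space with a commutative associative product $\cdot$ and a Novikov product $\circ$, i.e. a bilinear product with $(x\circ y)\circ z-x\circ(y\circ z)=(y\circ x)\circ z-y\circ(x\circ z)$ and $(x\circ y)\circ z=(x\circ z)\circ y$, such that $(x\cdot y)\circ z=x\cdot(y\circ z)$ and $(x\circ y)\cdot z-(y\circ x)\cdot z=x\circ(y\cdot z)-y\circ(x\cdot z)$. It is nonzero if the two products are not both zero. Isomorphisms are linear bijections preserving both products. In multiplication tables, products of basis elements not listed are zero, except that $e_2\cdot e_1=e_1\cdot e_2$ by commutativity of $\cdot$. *)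

theory Defs
  imports "HOL-Analysis.Analysis"
begin

definition bilinear_product ::
  "(complex \<Rightarrow> 'v::ab_group_add \<Rightarrow> 'v) \<Rightarrow> ('v \<Rightarrow> 'v \<Rightarrow> 'v) \<Rightarrow> bool" where
  "bilinear_product smul p \<longleftrightarrow>
     (\<forall>x. Vector_Spaces.linear smul smul (\<lambda>y. p x y)) \<and>
     (\<forall>y. Vector_Spaces.linear smul smul (\<lambda>x. p x y))"

locale novikov_poisson_algebra = vector_space smul
  for smul :: "complex \<Rightarrow> 'v::ab_group_add \<Rightarrow> 'v" +
  fixes dot :: "'v \<Rightarrow> 'v \<Rightarrow> 'v" (infixl "\<odot>" 70)
    and nov :: "'v \<Rightarrow> 'v \<Rightarrow> 'v" (infixl "\<star>" 70)
  assumes dot_bilinear: "bilinear_product smul (\<odot>)"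
    and dot_commute: "x \<odot> y = y \<odot> x"
    and dot_assoc: "(x \<odot> y) \<odot> z = x \<odot> (y \<odot> z)"
    and nov_bilinear: "bilinear_product smul (\<star>)"
    and nov_left_symmetric:
      "(x \<star> y) \<star> z - x \<star> (y \<star> z) = (y \<star> x) \<star> z - y \<star> (x \<star> z)"
    and nov_right_commute: "(x \<star> y) \<star> z = (x \<star> z) \<star> y"
    and dot_nov: "(x \<odot> y) \<star> z = x \<odot> (y \<star> z)"
    and nov_dot:
      "(x \<star> y) \<odot> z - (y \<star> x) \<odot> z = x \<star> (y \<odot> z) - y \<star> (x \<odot> z)"

definition np_isomorphic ::
  "(complex \<Rightarrow> 'v::ab_group_add \<Rightarrow> 'v) \<Rightarrow> ('v \<Rightarrow> 'v \<Rightarrow> 'v) \<Rightarrow> ('v \<Rightarrow> 'v \<Rightarrow> 'v) \<Rightarrow>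
   (complex \<Rightarrow> 'w::ab_group_add \<Rightarrow> 'w) \<Rightarrow> ('w \<Rightarrow> 'w \<Rightarrow> 'w) \<Rightarrow> ('w \<Rightarrow> 'w \<Rightarrow> 'w) \<Rightarrow> bool" where
  "np_isomorphic smul dot nov smul' dot' nov' \<longleftrightarrow>
     (\<exists>f. Vector_Spaces.linear smul smul' f \<and> bij f \<and>
        (\<forall>x y. f (dot x y) = dot' (f x) (f y)) \<and>
        (\<forall>x y. f (nov x y) = nov' (f x) (f y)))"

abbreviation e1 :: "complex ^ 2" where "e1 \<equiv> axis 1 1"
abbreviation e2 :: "complex ^ 2" where "e2 \<equiv> axis 2 1"

text \<open>
  \<open>mult_table a b c d\<close> is the bilinear product on \<open>complex ^ 2\<close> whose values on the pairs
  (e1, e1), (e1, e2), (e2, e1), (e2, e2) are \<open>a\<close>, \<open>b\<close>, \<open>c\<close>, \<open>d\<close>, in this order.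
\<close>

definition mult_table ::
  "complex ^ 2 \<Rightarrow> complex ^ 2 \<Rightarrow> complex ^ 2 \<Rightarrow> complex ^ 2 \<Rightarrow> complex ^ 2 \<Rightarrow> complex ^ 2 \<Rightarrow> complex ^ 2"
where
  "mult_table a b c d x y =
     (x $ 1 * y $ 1) *s a + (x $ 1 * y $ 2) *s b + (x $ 2 * y $ 1) *s c + (x $ 2 * y $ 2) *s d"

datatype zero_dot_alg = N01 | N02 | N03 | N04 | N05 | N06 complex

datatype nonzero_dot_alg =
    N07 complex complex | N08 complex complex | N09 complex complex
  | N10 complex | N11 complex | N12 complex | N13 complex | N14 complex

text \<open>The dot product of every \<open>zero_dot_alg\<close> is zero.\<close>

fun nov_zero_dot :: "zero_dot_alg \<Rightarrow> complex ^ 2 \<Rightarrow> complex ^ 2 \<Rightarrow> complex ^ 2" where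
  "nov_zero_dot N01 = mult_table e2 0 0 0"
| "nov_zero_dot N02 = mult_table 0 0 (- e1) 0"
| "nov_zero_dot N03 = mult_table e1 0 0 e2"
| "nov_zero_dot N04 = mult_table e1 0 0 0"
| "nov_zero_dot N05 = mult_table 0 e1 0 (e1 + e2)"
| "nov_zero_dot (N06 \<gamma>) = mult_table 0 e1 (\<gamma> *s e1) e2"

fun dot_nonzero_dot :: "nonzero_dot_alg \<Rightarrow> complex ^ 2 \<Rightarrow> complex ^ 2 \<Rightarrow> complex ^ 2" where
  "dot_nonzero_dot (N07 \<alpha> \<beta>) = mult_table e1 0 0 e2"
| "dot_nonzero_dot (N08 \<alpha> \<beta>) = mult_table e1 e2 e2 0"
| "dot_nonzero_dot (N09 \<alpha> \<beta>) = mult_table e1 e2 e2 0"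
| "dot_nonzero_dot (N10 \<alpha>) = mult_table e1 0 0 0"
| "dot_nonzero_dot (N11 \<alpha>) = mult_table e1 0 0 0"
| "dot_nonzero_dot (N12 \<alpha>) = mult_table e2 0 0 0"
| "dot_nonzero_dot (N13 \<alpha>) = mult_table e2 0 0 0"
| "dot_nonzero_dot (N14 \<alpha>) = mult_table e2 0 0 0"

fun nov_nonzero_dot :: "nonzero_dot_alg \<Rightarrow> complex ^ 2 \<Rightarrow> complex ^ 2 \<Rightarrow> complex ^ 2" where
  "nov_nonzero_dot (N07 \<alpha> \<beta>) = mult_table (\<alpha> *s e1) 0 0 (\<beta> *s e2)"
| "nov_nonzero_dot (N08 \<alpha> \<beta>) = mult_table (\<alpha> *s e1 + e2) (\<beta> *s e2) (\<alpha> *s e2) 0"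
| "nov_nonzero_dot (N09 \<alpha> \<beta>) = mult_table (\<alpha> *s e1) (\<beta> *s e2) (\<alpha> *s e2) 0"
| "nov_nonzero_dot (N10 \<alpha>) = mult_table (\<alpha> *s e1) 0 0 e2"
| "nov_nonzero_dot (N11 \<alpha>) = mult_table (\<alpha> *s e1) 0 0 0"
| "nov_nonzero_dot (N12 \<alpha>) = mult_table (\<alpha> *s e1) e2 (\<alpha> *s e2) 0"
| "nov_nonzero_dot (N13 \<alpha>) = mult_table (e1 + \<alpha> *s e2) 0 e2 0"
| "nov_nonzero_dot (N14 \<alpha>) = mult_table (\<alpha> *s e2) 0 0 0"

lemma mult_table_basis:
  "mult_table a b c d e1 e1 = a" "mult_table a b c d e1 e2 = b"
  "mult_table a b c d e2 e1 = c" "mult_table a b c d e2 e2 = d"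
  by (simp_all add: mult_table_def axis_def vec_eq_iff)

lemma bilinear_product_mult_table: "bilinear_product (*s) (mult_table a b c d)"
  unfolding bilinear_product_def Vector_Spaces.linear_iff
  by (auto simp: mult_table_def vec_eq_iff algebra_simps vec.vector_space_axioms)

lemma novikov_poisson_zero_dot:
  "novikov_poisson_algebra (*s) (\<lambda>_ _. 0) (nov_zero_dot A)"
proof -
  have *: "bilinear_product (*s) (\<lambda>_ _. 0 :: complex ^ 2)"
    by (simp add: bilinear_product_def Vector_Spaces.linear_iff vec.vector_space_axioms)
  show ?thesis
    by (cases A; unfold_locales;
        simp add: * bilinear_product_mult_table;
        simp add: mult_table_def vec_eq_iff forall_2 axis_def algebra_simps)
qed

lemma novikov_poisson_nonzero_dot:
  "novikov_poisson_algebra (*s) (dot_nonzero_dot A) (nov_nonzero_dot A)"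
  by (cases A; unfold_locales;
      simp add: bilinear_product_mult_table;
      simp add: mult_table_def vec_eq_iff forall_2 axis_def algebra_simps)

end

theory Submission
  imports Defs
begin

text \<open>
  After transport to \<open>complex ^ 2\<close>, one chooses a basis adapted to \<open>\<cdot>\<close> and reads off the
  constraints that the axioms put on the structure constants of \<open>\<circ>\<close>. If \<open>\<cdot>\<close> is nonzero, then
  either it has a nonzero idempotent, and the Peirce decomposition leads to \<open>\<complex> \<times> \<complex>\<close>,
  \<open>\<complex>[t]/(t\<^sup>2)\<close> or \<open>\<complex> \<times> \<complex>t\<close> with \<open>t\<^sup>2 = 0\<close>, or \<open>u, u\<^sup>2\<close> is a basis with
  \<open>u\<^sup>3 = 0\<close> for some \<open>u\<close>. If \<open>\<cdot>\<close> is zero, the right multiplications of \<open>\<circ>\<close> commute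
  and hence have a common eigenvector. In both cases the remaining freedom in the basis
  normalises the constants. For the non-isomorphism statement, an isomorphism preserves the
  type of \<open>\<cdot>\<close>, and the few linear maps which preserve \<open>\<cdot>\<close> act on the constants of \<open>\<circ>\<close> in
  an explicit way.
\<close>

section \<open>Transport of structure and tables of structure constants\<close>

lemma bilinear_productD:
  assumes "bilinear_product smul p"
  shows "p (x + y) z = p x z + p y z" "p x (y + z) = p x y + p x z"
    "p (smul c x) z = smul c (p x z)" "p x (smul c z) = smul c (p x z)"
  using assms unfolding bilinear_product_def Vector_Spaces.linear_iff by blast+

lemma np_isomorphic_trans:
  assumes "np_isomorphic s1 d1 n1 s2 d2 n2" "np_isomorphic s2 d2 n2 s3 d3 n3"
  shows "np_isomorphic s1 d1 n1 s3 d3 n3"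
proof -
  obtain f where f: "Vector_Spaces.linear s1 s2 f" "bij f"
    "\<And>x y. f (d1 x y) = d2 (f x) (f y)" "\<And>x y. f (n1 x y) = n2 (f x) (f y)"
    using assms(1) unfolding np_isomorphic_def by blast
  obtain g where g: "Vector_Spaces.linear s2 s3 g" "bij g"
    "\<And>x y. g (d2 x y) = d3 (g x) (g y)" "\<And>x y. g (n2 x y) = n3 (g x) (g y)"
    using assms(2) unfolding np_isomorphic_def by blast
  show ?thesis unfolding np_isomorphic_def
    using f g by (intro exI[of _ "g \<circ> f"]) (auto simp: Vector_Spaces.linear_iff bij_comp)
qed

text \<open>The axioms are identities, and the target products are the source products conjugated by
  the bijection, so each identity pulls back along its inverse. Linearity of \<open>f\<close> is
  needed where differences occur.\<close>

lemma novikov_poisson_transfer: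
  assumes "novikov_poisson_algebra s1 d1 n1" "np_isomorphic s1 d1 n1 s2 d2 n2"
  shows "novikov_poisson_algebra s2 d2 n2"
proof -
  obtain f where f: "Vector_Spaces.linear s1 s2 f" "bij f"
    and d: "\<And>x y. f (d1 x y) = d2 (f x) (f y)" and n: "\<And>x y. f (n1 x y) = n2 (f x) (f y)"
    using assms(2) unfolding np_isomorphic_def by blast
  interpret A: novikov_poisson_algebra s1 d1 n1 by fact
  interpret f: Vector_Spaces.linear s1 s2 f by fact
  define g where "g = inv f"
  have fg: "f (g x) = x" for x
    using f(2) by (simp add: g_def bij_is_surj surj_f_inv_f)
  have d': "d2 x y = f (d1 (g x) (g y))" and n': "n2 x y = f (n1 (g x) (g y))" for x y
    by (simp_all add: d n fg)
  have gf: "g (f x) = x" for x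
    using f(2) by (simp add: g_def bij_is_inj)
  have g: "g (x + y) = g x + g y" "g (s2 c x) = s1 c (g x)" for x y c
    by (metis f.add f.scale fg gf)+
  note bil = bilinear_productD[OF A.dot_bilinear] bilinear_productD[OF A.nov_bilinear]
  show ?thesis
  proof unfold_locales
    show "bilinear_product s2 d2" "bilinear_product s2 n2"
      unfolding bilinear_product_def Vector_Spaces.linear_iff d' n'
      by (auto simp: f.vs2.vector_space_axioms g bil f.add f.scale)
    show "d2 x y = d2 y x" for x y by (simp add: d' A.dot_commute)
    show "d2 (d2 x y) z = d2 x (d2 y z)" for x y z by (simp add: d' gf A.dot_assoc)
    show "n2 (n2 x y) z = n2 (n2 x z) y" for x y z
      using A.nov_right_commute by (simp add: n' gf)
    show "n2 (d2 x y) z = d2 x (n2 y z)" for x y z by (simp add: d' n' gf A.dot_nov)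
    show "n2 (n2 x y) z - n2 x (n2 y z) = n2 (n2 y x) z - n2 y (n2 x z)" for x y z
      using A.nov_left_symmetric[of "g x" "g y" "g z"] by (simp add: n' gf flip: f.diff)
    show "d2 (n2 x y) z - d2 (n2 y x) z = n2 x (d2 y z) - n2 y (d2 x z)" for x y z
      using A.nov_dot[of "g x" "g y" "g z"] by (simp add: n' d' gf flip: f.diff)
  qed
qed

text \<open>The isomorphism takes coordinates with respect to the basis \<open>u\<close>,
  \<open>v\<close>. By bilinearity it respects a product as soon as the four products of basis
  vectors match.\<close>

lemma np_isomorphic_mult_tableI:
  fixes smul :: "complex \<Rightarrow> 'v::ab_group_add \<Rightarrow> 'v"
  assumes "vector_space smul" "bilinear_product smul dot" "bilinear_product smul nov"
    and indep: "\<And>s t. smul s u + smul t v = 0 \<Longrightarrow> s = 0 \<and> t = 0"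
    and span: "\<And>x. \<exists>s t. x = smul s u + smul t v"
    and dot: "dot u u = smul (a $ 1) u + smul (a $ 2) v" "dot u v = smul (b $ 1) u + smul (b $ 2) v"
      "dot v u = smul (c $ 1) u + smul (c $ 2) v" "dot v v = smul (d $ 1) u + smul (d $ 2) v"
    and nov: "nov u u = smul (a' $ 1) u + smul (a' $ 2) v" "nov u v = smul (b' $ 1) u + smul (b' $ 2) v"
      "nov v u = smul (c' $ 1) u + smul (c' $ 2) v" "nov v v = smul (d' $ 1) u + smul (d' $ 2) v"
  shows "np_isomorphic smul dot nov (*s) (mult_table a b c d) (mult_table a' b' c' d')"
proof -
  interpret vector_space smul by fact
  \<comment> \<open>\<open>g\<close> is the inverse of the wanted isomorphism. It is easier to write
    down, since it only forms combinations of \<open>u\<close> and \<open>v\<close>.\<close>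
  define g where "g x = smul (x $ 1) u + smul (x $ 2) v" for x :: "complex ^ 2"
  have g_add: "g (x + y) = g x + g y" and g_scale: "g (k *s x) = smul k (g x)" for x y k
    by (simp_all add: g_def algebra_simps)
  have "inj g"
  proof (rule injI)
    fix x y assume "g x = g y"
    then have "smul (x $ 1 - y $ 1) u + smul (x $ 2 - y $ 2) v = 0"
      by (simp add: g_def scale_left_diff_distrib algebra_simps)
    then show "x = y" using indep by (fastforce simp: vec_eq_iff forall_2)
  qed
  have "surj g"
  proof (rule surjI)
    fix x
    show "g (SOME y. g y = x) = x"
    proof (rule someI_ex)
      obtain s t where "x = smul s u + smul t v" using span by blast
      then show "\<exists>y. g y = x" by (intro exI[of _ "vector [s, t]"]) (simp add: g_def)
    qed
  qed
  define f where "f = inv g"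
  have gf: "g (f x) = x" and fg: "f (g y) = y" for x y
    using \<open>inj g\<close> \<open>surj g\<close> by (simp_all add: f_def surj_f_inv_f)
  have "bij f" using \<open>inj g\<close> \<open>surj g\<close> unfolding f_def by (intro bij_imp_bij_inv bijI)
  have f_lin: "f (x + y) = f x + f y" "f (smul k x) = k *s f x" for x y k
    by (metis g_add g_scale gf fg)+
  have mult: "g (mult_table a b c d x y) = p (g x) (g y)"
    if "bilinear_product smul p" "p u u = g a" "p u v = g b" "p v u = g c" "p v v = g d"
    for p a b c d x y
  proof -
    have "p (g x) (g y) = smul (x $ 1 * y $ 1) (g a) + smul (x $ 1 * y $ 2) (g b)
        + smul (x $ 2 * y $ 1) (g c) + smul (x $ 2 * y $ 2) (g d)"
      using that(2-)
      by (subst (1 2) g_def) (simp add: bilinear_productD[OF that(1)] algebra_simps)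
    then show ?thesis by (simp add: mult_table_def g_add g_scale)
  qed
  have "f (dot x y) = mult_table a b c d (f x) (f y)" for x y
    using mult[OF assms(2), of a b c d "f x" "f y"] dot by (metis g_def fg gf)
  moreover have "f (nov x y) = mult_table a' b' c' d' (f x) (f y)" for x y
    using mult[OF assms(3), of a' b' c' d' "f x" "f y"] nov by (metis g_def fg gf)
  moreover have "Vector_Spaces.linear smul (*s) f"
    unfolding Vector_Spaces.linear_iff
    by (simp add: f_lin vector_space_axioms vec.vector_space_axioms)
  ultimately show ?thesis
    unfolding np_isomorphic_def using \<open>bij f\<close> by blast
qed

text \<open>This moves an abstract algebra to \<open>complex ^ 2\<close>, where the axioms become
  polynomial equations in the structure constants.\<close>

lemma np_isomorphic_mult_table:
  fixes smul :: "complex \<Rightarrow> 'v::ab_group_add \<Rightarrow> 'v"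
  assumes "novikov_poisson_algebra smul dot nov" "vector_space.dim smul UNIV = 2"
  shows "\<exists>a b c d a' b' c' d'.
    np_isomorphic smul dot nov (*s) (mult_table a b c d) (mult_table a' b' c' d')"
proof -
  interpret novikov_poisson_algebra smul dot nov by fact
  obtain B where B: "independent B" "span B = UNIV" "card B = 2"
    using basis_exists[of UNIV] assms(2) by (metis top.extremum_uniqueI)
  then obtain u v where uv: "B = {u, v}" "u \<noteq> v" by (meson card_2_iff)
  have span_uv: "\<exists>s t. x = smul s u + smul t v" for x
  proof -
    have "x \<in> span {u, v}" using B uv by simp
    then obtain s where "x - smul s u \<in> span {v}" using span_breakdown_eq by blast
    then obtain t where "x - smul s u = smul t v" by (auto simp: span_singleton)
    then show ?thesis by (metis add.commute diff_add_cancel)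
  qed
  have indep: "s = 0 \<and> t = 0" if "smul s u + smul t v = 0" for s t
  proof -
    let ?c = "\<lambda>w. if w = u then s else t"
    have "(\<Sum>w\<in>{u, v}. smul (?c w) w) = 0"
      using uv(2) that by simp
    then have "?c w = 0" if "w \<in> {u, v}" for w
      using independentD[OF B(1), of "{u, v}" ?c w] uv(1) that by simp
    from this[of u] this[of v] show ?thesis using uv(2) by auto
  qed
  have "\<exists>w :: complex ^ 2. x = smul (w $ 1) u + smul (w $ 2) v" for x
    using span_uv[of x] by (metis vector_2)
  then show ?thesis
    using np_isomorphic_mult_tableI[OF vector_space_axioms dot_bilinear nov_bilinear indep span_uv]
    by metis
qed

section \<open>Bases of the plane via determinants, and change of basis\<close>

definition det2 :: "complex ^ 2 \<Rightarrow> complex ^ 2 \<Rightarrow> complex" where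
  "det2 u v = u $ 1 * v $ 2 - u $ 2 * v $ 1"

lemmas coords = mult_table_def vec_eq_iff forall_2 axis_def det2_def

lemma det2_eq_0_iff:
  assumes "u \<noteq> 0"
  shows "det2 u v = 0 \<longleftrightarrow> (\<exists>k. v = k *s u)"
proof
  assume 0: "det2 u v = 0"
  show "\<exists>k. v = k *s u"
  proof (cases "u $ 1 = 0")
    case True
    then show ?thesis using assms 0
      by (intro exI[of _ "v $ 2 / u $ 2"]) (auto simp: det2_def vec_eq_iff forall_2)
  next
    case False
    then show ?thesis using assms 0
      by (intro exI[of _ "v $ 1 / u $ 1"]) (auto simp: det2_def vec_eq_iff forall_2 field_simps)
  qed
qed (auto simp: det2_def)

lemma det2_complement:
  assumes "u \<noteq> 0"
  obtains v where "det2 u v \<noteq> 0"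
proof -
  have "det2 u e1 \<noteq> 0 \<or> det2 u e2 \<noteq> 0"
    using assms by (auto simp: det2_def vec_eq_iff forall_2 axis_def)
  then show ?thesis using that by blast
qed

lemma det2_span:
  assumes "det2 u v \<noteq> 0"
  obtains s t where "x = s *s u + t *s v"
proof
  \<comment> \<open>Cramer's rule.\<close>
  show "x = (det2 x v / det2 u v) *s u + (det2 u x / det2 u v) *s v"
    using assms by (simp add: vec_eq_iff forall_2 divide_simps)
      (simp add: det2_def algebra_simps)
qed

lemma det2_indep:
  assumes "det2 u v \<noteq> 0" "s *s u + t *s v = s' *s u + t' *s v"
  shows "s = s' \<and> t = t'"
proof -
  \<comment> \<open>The determinant with \<open>v\<close>, respectively \<open>u\<close>, isolates
    one coefficient.\<close>
  have "s * det2 u v = det2 (s *s u + t *s v) v" "t * det2 u v = det2 u (s *s u + t *s v)"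
    "s' * det2 u v = det2 (s' *s u + t' *s v) v" "t' * det2 u v = det2 u (s' *s u + t' *s v)"
    by (simp_all add: det2_def algebra_simps)
  then show ?thesis using assms by (metis mult_right_cancel)
qed

lemma np_isomorphic_change_basis:
  fixes P Q :: "complex ^ 2 \<Rightarrow> complex ^ 2 \<Rightarrow> complex ^ 2"
  assumes "bilinear_product (*s) P" "bilinear_product (*s) Q" "det2 u v \<noteq> 0"
    "P u u = (a $ 1) *s u + (a $ 2) *s v" "P u v = (b $ 1) *s u + (b $ 2) *s v"
    "P v u = (c $ 1) *s u + (c $ 2) *s v" "P v v = (d $ 1) *s u + (d $ 2) *s v"
    "Q u u = (a' $ 1) *s u + (a' $ 2) *s v" "Q u v = (b' $ 1) *s u + (b' $ 2) *s v"
    "Q v u = (c' $ 1) *s u + (c' $ 2) *s v" "Q v v = (d' $ 1) *s u + (d' $ 2) *s v"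
  shows "np_isomorphic (*s) P Q (*s) (mult_table a b c d) (mult_table a' b' c' d')"
proof (rule np_isomorphic_mult_tableI[OF vec.vector_space_axioms assms(1,2)])
  show "s = 0 \<and> t = 0" if "s *s u + t *s v = 0" for s t
    using det2_indep[OF assms(3), of s t 0 0] that by simp
  show "\<exists>s t. x = s *s u + t *s v" for x
    using det2_span[OF assms(3)] by metis
qed fact+

text \<open>For a basis that normalises only the first product: the constants of the second exist
  because \<open>u\<close>, \<open>v\<close> span, and remain unspecified.\<close>

lemma np_isomorphic_change_dot:
  fixes P Q :: "complex ^ 2 \<Rightarrow> complex ^ 2 \<Rightarrow> complex ^ 2"
  assumes "bilinear_product (*s) P" "bilinear_product (*s) Q" "det2 u v \<noteq> 0"
    "P u u = (a $ 1) *s u + (a $ 2) *s v" "P u v = (b $ 1) *s u + (b $ 2) *s v"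
    "P v u = (c $ 1) *s u + (c $ 2) *s v" "P v v = (d $ 1) *s u + (d $ 2) *s v"
  shows "\<exists>a' b' c' d'. np_isomorphic (*s) P Q (*s) (mult_table a b c d) (mult_table a' b' c' d')"
proof -
  have "\<exists>w :: complex ^ 2. x = (w $ 1) *s u + (w $ 2) *s v" for x
    using det2_span[OF assms(3)] by (metis vector_2)
  then show ?thesis using np_isomorphic_change_basis[OF assms] by metis
qed

subsection \<open>Normal forms of the commutative associative product\<close>

locale plane_np_algebra =
  novikov_poisson_algebra "(*s)" P Q for P Q :: "complex ^ 2 \<Rightarrow> complex ^ 2 \<Rightarrow> complex ^ 2"
begin

lemmas P = bilinear_productD[OF dot_bilinear]
lemmas Q = bilinear_productD[OF nov_bilinear]

lemma dot_zero: "P 0 x = 0" "P x 0 = 0"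
  using P(1)[of 0 0 x] P(2)[of x 0 0] by simp_all

lemma dot_diff: "P (x - y) z = P x z - P y z" "P x (y - z) = P x y - P x z"
  using P(1)[of "x - y" y z] P(2)[of x "y - z" z] by simp_all

text \<open>The triple \<open>(a, b, c)\<close> holds the coordinates of \<open>u u\<close>,
  \<open>u v\<close>, \<open>v v\<close>. If \<open>e\<close> is a unit, completing the square gives
  \<open>w\<close> with \<open>w w\<close> a multiple of \<open>e\<close>: multiple zero means dual
  numbers, otherwise the algebra splits into two copies of the field. If \<open>e\<close> is not a
  unit, it annihilates some \<open>w\<close> outside its span, and \<open>w w\<close> is a multiple
  of \<open>w\<close>.\<close>

lemma dot_basis_of_idempotent:
  assumes e: "P e e = e" "e \<noteq> 0"
  shows "\<exists>u v a b c. (a, b, c) \<in> {(e1, 0, e2), (e1, e2, 0), (e1, 0, 0)} \<and>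
    det2 u v \<noteq> 0 \<and> P u u = (a $ 1) *s u + (a $ 2) *s v \<and>
    P u v = (b $ 1) *s u + (b $ 2) *s v \<and> P v v = (c $ 1) *s u + (c $ 2) *s v"
proof (cases "\<forall>x. P e x = x")
  case unit: True
  obtain v where v: "det2 e v \<noteq> 0" using det2_complement[OF e(2)] .
  obtain p q where vv: "P v v = p *s e + q *s v" using det2_span[OF v] .
  \<comment> \<open>Completing the square removes the linear term of
    \<open>v v = p e + q v\<close>.\<close>
  define w where "w = v - (q / 2) *s e"
  have ww: "P w w = (p + q\<^sup>2 / 4) *s e" and ew: "P e w = w" and we: "P w e = w"
    using unit dot_commute[of _ e]
    by (simp_all add: w_def dot_diff P vv) (simp add: vec_eq_iff power2_eq_square algebra_simps)
  have w: "det2 e w \<noteq> 0"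
    using v by (simp add: det2_def w_def algebra_simps)
  define r where "r = csqrt (p + q\<^sup>2 / 4)"
  show ?thesis
  proof (cases "r = 0")
    case True
    then show ?thesis using w e(1) ww ew
      by (intro exI[of _ e] exI[of _ w] exI[of _ e1] exI[of _ e2] exI[of _ 0])
        (simp add: axis_def r_def)
  next
    case False
    have r2: "p + q\<^sup>2 / 4 = r * r"
      by (simp add: r_def flip: power2_eq_square)
    \<comment> \<open>Since \<open>w w = r r e\<close>, the elements \<open>(e + w / r) / 2\<close>
      and \<open>(e - w / r) / 2\<close> are orthogonal idempotents.\<close>
    let ?u = "(1 / 2) *s (e + (1 / r) *s w)" and ?v = "(1 / 2) *s (e - (1 / r) *s w)"
    have "det2 ?u ?v \<noteq> 0"
    proof -
      have "det2 ?u ?v = - (1 / (2 * r)) * det2 e w"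
        using False by (simp add: det2_def field_simps)
      then show ?thesis using w False by simp
    qed
    moreover have "P ?u ?u = ?u" "P ?u ?v = 0" "P ?v ?v = ?v"
      using False by (simp_all add: P dot_diff e(1) ew we ww r2 vec_eq_iff field_simps)
    ultimately show ?thesis
      by (intro exI[of _ ?u] exI[of _ ?v] exI[of _ e1] exI[of _ 0] exI[of _ e2])
        (simp add: axis_def)
  qed
next
  case False
  then obtain x where x: "P e x \<noteq> x" by blast
  define w where "w = x - P e x"
  have ew: "P e w = 0" and "w \<noteq> 0"
    using x by (simp_all add: w_def dot_diff e(1) flip: dot_assoc)
  have w: "det2 e w \<noteq> 0"
  proof
    assume "det2 e w = 0"
    then obtain k where "w = k *s e" using det2_eq_0_iff[OF e(2)] by blast
    then show False using ew \<open>w \<noteq> 0\<close> by (simp add: P e(1))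
  qed
  obtain p q where ww: "P w w = p *s e + q *s w" using det2_span[OF w] .
  \<comment> \<open>Associativity lets \<open>e\<close> annihilate \<open>w w\<close>, which removes
    its \<open>e\<close> component.\<close>
  have "P e (P w w) = 0" using dot_assoc[of e w w] by (simp add: ew dot_zero)
  then have "p *s e = 0" by (simp add: ww P e(1) ew)
  then have ww: "P w w = q *s w" using ww by simp
  show ?thesis
  proof (cases "q = 0")
    case True
    then show ?thesis using w ww ew e(1)
      by (intro exI[of _ e] exI[of _ w] exI[of _ e1] exI[of _ 0] exI[of _ 0])
        (simp add: axis_def)
  next
    case False
    let ?v = "(1 / q) *s w"
    have "det2 e ?v \<noteq> 0" using w False by (simp add: det2_def field_simps)
    moreover have "P ?v ?v = ?v" "P e ?v = 0" using False by (simp_all add: P ww ew)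
    ultimately show ?thesis using e(1)
      by (intro exI[of _ e] exI[of _ ?v] exI[of _ e1] exI[of _ 0] exI[of _ e2])
        (simp add: axis_def)
  qed
qed

text \<open>Without nonzero idempotents, take \<open>u\<close> with nonzero square \<open>v\<close>.
  The two are independent, as otherwise a multiple of \<open>u\<close> would be idempotent. In
  \<open>u v = p u + q v\<close> a nonzero \<open>p\<close> would produce a unit, and then a nonzero
  \<open>q\<close> would make a multiple of \<open>v\<close> idempotent, so
  \<open>u v = 0\<close>.\<close>

lemma dot_basis:
  assumes "P x y \<noteq> 0"
  shows "\<exists>u v a b c. (a, b, c) \<in> {(e1, 0, e2), (e1, e2, 0), (e1, 0, 0), (e2, 0, 0)} \<and>
    det2 u v \<noteq> 0 \<and> P u u = (a $ 1) *s u + (a $ 2) *s v \<and>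
    P u v = (b $ 1) *s u + (b $ 2) *s v \<and> P v v = (c $ 1) *s u + (c $ 2) *s v"
proof (cases "\<exists>e. P e e = e \<and> e \<noteq> 0")
  case True
  then show ?thesis using dot_basis_of_idempotent by fast
next
  case False
  then have no_idem: "P e e = e \<Longrightarrow> e = 0" for e by blast
  have no_idem': "P e e = k *s e \<Longrightarrow> k = 0 \<or> e = 0" for e k
    using no_idem[of "(1 / k) *s e"] by (auto simp: P)
  \<comment> \<open>Polarisation: if all squares vanish, so does \<open>2 x y\<close>.\<close>
  have "\<exists>u. P u u \<noteq> 0"
  proof (rule ccontr)
    assume "\<not> ?thesis"
    then have "P (x + y) (x + y) = 0" "P x x = 0" "P y y = 0" by blast+
    then have "P x y + P x y = 0" using dot_commute[of x y] by (simp add: P)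
    then have "P x y = 0" by (simp add: vec_eq_iff)
    then show False using assms by simp
  qed
  then obtain u where u: "P u u \<noteq> 0" by blast
  then have "u \<noteq> 0" using dot_zero by blast
  define v where "v = P u u"
  have uv: "det2 u v \<noteq> 0"
    using no_idem'[of u] u det2_eq_0_iff[OF \<open>u \<noteq> 0\<close>, of v] \<open>u \<noteq> 0\<close> unfolding v_def by fastforce
  have "v \<noteq> 0" using u v_def by simp
  obtain p q where Puv: "P u v = p *s u + q *s v" using det2_span[OF uv] .
  have Pvu: "P v u = p *s u + q *s v" using Puv dot_commute by simp
  have uu: "P u u = v" by (simp add: v_def)
  have vv: "P v v = p *s v + q *s (P u v)"
    using dot_assoc[of u u v] by (simp add: uu Puv P)
  have "p = 0"
  proof (rule ccontr)
    assume p: "p \<noteq> 0"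
    \<comment> \<open>The relation \<open>u v - q v = p u\<close> with \<open>v = u u\<close> shows
      that \<open>(v - q u) / p\<close> acts as the identity on \<open>u\<close>, hence also on
      \<open>v\<close>.\<close>
    define e where "e = (1 / p) *s (v - q *s u)"
    have "P e u = u" "P e v = v"
      using p by (simp_all add: e_def P dot_diff Pvu uu vv Puv vec_eq_iff field_simps)
    then have "P e e = e" by (subst (2) e_def) (simp add: P dot_diff e_def)
    then have "e = 0" using no_idem by blast
    then show False using \<open>P e u = u\<close> \<open>u \<noteq> 0\<close> by (simp add: dot_zero)
  qed
  moreover from this have "q = 0"
    using no_idem'[of v "q * q"] \<open>v \<noteq> 0\<close> vv Puv by auto
  ultimately show ?thesis using uv uu Puv vv
    by (intro exI[of _ u] exI[of _ v] exI[of _ e2] exI[of _ 0] exI[of _ 0])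
      (simp add: axis_def)
qed

end

subsection \<open>Algebras with zero commutative product\<close>

lemma plane_eigenvector:
  fixes T :: "complex ^ 2 \<Rightarrow> complex ^ 2"
  assumes add: "\<And>x y. T (x + y) = T x + T y" and scale: "\<And>k x. T (k *s x) = k *s T x"
  obtains u k where "u \<noteq> 0" "T u = k *s u"
proof (cases "det2 e1 (T e1) = 0")
  case True
  have "e1 \<noteq> (0 :: complex ^ 2)" by (simp add: axis_eq_0_iff)
  then obtain k where "T e1 = k *s e1" using True det2_eq_0_iff by blast
  then show ?thesis using that \<open>e1 \<noteq> 0\<close> by blast
next
  case False
  define v where "v = T e1"
  obtain p q where Tv: "T v = p *s e1 + q *s v" using det2_span[OF False] v_def by metis
  \<comment> \<open>In the basis \<open>e1\<close>, \<open>v\<close> the map is a companion matrix,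
    and \<open>l\<close> is a root of its characteristic polynomial \<open>l l - q l - p\<close>.
    Then \<open>(l - q) e1 + v\<close> is an eigenvector.\<close>
  define l where "l = (q + csqrt (q\<^sup>2 + 4 * p)) / 2"
  have "2 * l - q = csqrt (q\<^sup>2 + 4 * p)" by (simp add: l_def field_simps)
  then have "(2 * l - q)\<^sup>2 = q\<^sup>2 + 4 * p" by simp
  then have "4 * (p - (l * l - l * q)) = 0" by (simp add: power2_eq_square algebra_simps)
  then have l: "p = l * l - l * q" by (simp only: mult_eq_0_iff) simp
  let ?u = "(l - q) *s e1 + 1 *s v"
  have "T ?u = l *s ?u"
    by (simp only: add scale Tv l flip: v_def) (simp add: vec_eq_iff algebra_simps)
  moreover have "?u \<noteq> 0"
    using det2_indep[OF False, of "l - q" 1 0 0] v_def by auto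
  ultimately show ?thesis using that by blast
qed

context plane_np_algebra
begin

text \<open>Let \<open>u\<close> be an eigenvector of right multiplication by \<open>e1\<close>. If
  \<open>u\<close> is not one for \<open>e2\<close>, then \<open>u\<close> and \<open>Q u e2\<close>
  form a basis inside the same eigenspace, since the right multiplications commute. So right
  multiplication by \<open>e1\<close> is scalar, and any eigenvector for \<open>e2\<close>
  serves.\<close>

lemma nov_common_eigenvector:
  obtains u where "u \<noteq> 0" "\<And>x. \<exists>k. Q u x = k *s u"
proof -
  obtain u k where u: "u \<noteq> 0" "Q u e1 = k *s u"
    using plane_eigenvector[of "\<lambda>x. Q x e1"] Q by metis
  have Q_decomp: "Q w x = (x $ 1) *s Q w e1 + (x $ 2) *s Q w e2" for w x
  proof -
    have "x = (x $ 1) *s e1 + (x $ 2) *s e2" by (simp add: vec_eq_iff forall_2 axis_def)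
    then show ?thesis by (metis Q(2,4))
  qed
  note result = that
  have common: thesis if w: "w \<noteq> 0" "Q w e1 = k *s w" "Q w e2 = l *s w" for w k l
  proof (rule result)
    show "w \<noteq> 0" by fact
    have "Q w x = (x $ 1 * k + x $ 2 * l) *s w" for x
      using Q_decomp[of w x] by (simp add: w vec_eq_iff algebra_simps)
    then show "\<exists>k. Q w x = k *s w" for x by blast
  qed
  show ?thesis
  proof (cases "det2 u (Q u e2) = 0")
    case True
    then obtain l where "Q u e2 = l *s u" using det2_eq_0_iff u by blast
    then show ?thesis using common u by blast
  next
    case False
    have eig: "Q (Q u e2) e1 = k *s Q u e2"
      by (simp add: nov_right_commute[of u e2 e1] u(2) Q)
    have scalar: "Q x e1 = k *s x" for x
    proof -
      obtain s t where "x = s *s u + t *s Q u e2" using det2_span[OF False] .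
      then show ?thesis
        by (simp add: Q u(2) eig) (simp add: vec_eq_iff algebra_simps)
    qed
    obtain w l where "w \<noteq> 0" "Q w e2 = l *s w"
      using plane_eigenvector[of "\<lambda>x. Q x e2"] Q by metis
    then show ?thesis using common scalar by blast
  qed
qed

end

lemma mult_table_zero: "mult_table 0 0 0 0 = (\<lambda>_ _. 0)"
  by (intro ext) (simp add: mult_table_def)

lemma np_isomorphic_change_basis_zero_dot:
  assumes "bilinear_product (*s) Q" "det2 u v \<noteq> 0"
    "Q u u = (a $ 1) *s u + (a $ 2) *s v" "Q u v = (b $ 1) *s u + (b $ 2) *s v"
    "Q v u = (c $ 1) *s u + (c $ 2) *s v" "Q v v = (d $ 1) *s u + (d $ 2) *s v"
  shows "np_isomorphic (*s) (\<lambda>_ _. 0) Q (*s) (\<lambda>_ _. 0) (mult_table a b c d)"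
proof -
  have "bilinear_product (*s) (\<lambda>_ _. 0 :: complex ^ 2)"
    using bilinear_product_mult_table[of 0 0 0 0] by (simp add: mult_table_zero)
  from np_isomorphic_change_basis[OF this assms(1,2) _ _ _ _ assms(3-), of 0 0 0 0]
  show ?thesis by (simp add: mult_table_zero)
qed

text \<open>With the common eigenvector as first basis vector, both products
  \<open>e1 \<circ> x\<close> are multiples of \<open>e1\<close>. The axioms then leave five
  families of constants, each normalised by an explicit basis.\<close>

lemma classify_triangular_zero_dot:
  fixes a b c d p q :: complex
  defines "Q \<equiv> mult_table (a *s e1) (b *s e1) (c *s e1 + d *s e2) (p *s e1 + q *s e2)"
  assumes "novikov_poisson_algebra (*s) (\<lambda>_ _. 0) Q" and nonzero: "Q x y \<noteq> 0"
  shows "\<exists>A. np_isomorphic (*s) (\<lambda>_ _. 0) Q (*s) (\<lambda>_ _. 0) (nov_zero_dot A)"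
proof -
  interpret novikov_poisson_algebra "(*s)" "\<lambda>_ _. 0" Q by fact
  have bil: "bilinear_product (*s) Q" by (rule nov_bilinear)
  have 1: "d = 0 \<or> d = a" "b * a - c * a - d * b - d * c = 0"
    using nov_left_symmetric[of e1 e2 e1] by (auto simp add: Q_def coords algebra_simps)
  have 2: "b * b - p * a - q * b = d * p" "d = 0 \<or> q = b"
    using nov_left_symmetric[of e1 e2 e2] by (auto simp add: Q_def coords algebra_simps)
  have 3: "c * b + d * p = p * a + q * c"
    using nov_right_commute[of e2 e1 e2] by (simp add: Q_def coords algebra_simps)
  note iso = np_isomorphic_change_basis_zero_dot[OF bil]
  consider (A) "a \<noteq> 0" "d = a" "c = 0" "p = 0" "q = b"
    | (B) "a \<noteq> 0" "d = 0" "c = b" "p = (b\<^sup>2 - q * b) / a"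
    | (C) "a = 0" "d = 0" "b = 0" "c = 0"
    | (D) "a = 0" "d = 0" "b = 0" "c \<noteq> 0" "q = 0"
    | (E) "a = 0" "d = 0" "b \<noteq> 0" "q = b"
  proof (cases "a = 0")
    case True
    then have "d = 0" using 1 by simp
    then have "c * (b - q) = 0" "b * (b - q) = 0" using True 2 3 by (simp_all add: algebra_simps)
    then show ?thesis using that True \<open>d = 0\<close> by auto
  next
    case False
    show ?thesis
    proof (cases "d = 0")
      case True
      then have "(b - c) * a = 0" using 1 by (simp add: algebra_simps)
      then have "c = b" using False by simp
      moreover have "p * a = b\<^sup>2 - q * b" using 2 True by (simp add: power2_eq_square algebra_simps)
      ultimately show ?thesis using that(2) True False by (simp add: field_simps)
    next
      case d: False
      then have "d = a" using 1 by auto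
      moreover have "q = b" using 2 d by simp
      moreover have "c = 0" using 1 \<open>d = a\<close> False by (simp add: algebra_simps)
      moreover have "p = 0" using 2 \<open>d = a\<close> \<open>q = b\<close> False by (simp add: algebra_simps)
      ultimately show ?thesis using that(1) False by simp
    qed
  qed
  then show ?thesis
  proof cases
    case A
    \<comment> \<open>Here \<open>x \<circ> y\<close> is \<open>x\<close> times a linear form in
      \<open>y\<close> with values \<open>a\<close>, \<open>b\<close> on \<open>e1\<close>,
      \<open>e2\<close>. The new basis is a kernel vector and a vector of value 1.\<close>
    then show ?thesis
      by (intro exI[of _ "N06 0"], unfold nov_zero_dot.simps,
        intro iso[of "b *s e1 - a *s e2" "(1 / a) *s e1"])
        (simp_all add: Q_def coords field_simps)
  next
    case B
    \<comment> \<open>The product is commutative here, and \<open>e2 - k e1\<close> is orthogonal to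
      \<open>e1\<close> with square \<open>q (e2 - k e1)\<close>. Only rescaling remains.\<close>
    define k where "k = b / a"
    have k: "b = k * a" "c = k * a" "p = k * k * a - q * k"
      using B by (simp_all add: k_def field_simps power2_eq_square)
    show ?thesis
    proof (cases "q = 0")
      case True
      then show ?thesis using B(1,2)
        by (intro exI[of _ N04], unfold nov_zero_dot.simps,
          intro iso[of "(1 / a) *s e1" "e2 - k *s e1"])
          (simp_all add: Q_def coords k field_simps power2_eq_square)
    next
      case False
      then show ?thesis using B(1,2)
        by (intro exI[of _ N03], unfold nov_zero_dot.simps,
          intro iso[of "(1 / a) *s e1" "(1 / q) *s (e2 - k *s e1)"])
          (simp_all add: Q_def coords k field_simps power2_eq_square)
    qed
  next
    case C
    show ?thesis
    proof (cases "q = 0")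
      case True
      then have "p \<noteq> 0" using C nonzero by (auto simp: Q_def coords)
      then show ?thesis using C True
        by (intro exI[of _ N01], unfold nov_zero_dot.simps, intro iso[of e2 "p *s e1"])
          (simp_all add: Q_def coords)
    next
      \<comment> \<open>With \<open>w = p e1 + q e2\<close> one has
        \<open>w \<circ> w = q q w\<close>, so \<open>w / (q q)\<close> is idempotent.\<close>
      case False
      then show ?thesis using C
        by (intro exI[of _ N04], unfold nov_zero_dot.simps,
          intro iso[of "(1 / q\<^sup>2) *s (p *s e1 + q *s e2)" e1])
          (simp_all add: Q_def coords field_simps power2_eq_square)
    qed
  next
    case D
    \<comment> \<open>The \<open>e1\<close> summand of the second basis vector is chosen to make its
      square vanish.\<close>
    then show ?thesis
      by (intro exI[of _ N02], unfold nov_zero_dot.simps,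
        intro iso[of e1 "(p / c\<^sup>2) *s e1 - (1 / c) *s e2"])
        (simp_all add: Q_def coords field_simps power2_eq_square)
  next
    case E
    show ?thesis
    proof (cases "c = 0 \<and> p \<noteq> 0")
      case True
      then show ?thesis using E
        by (intro exI[of _ N05], unfold nov_zero_dot.simps,
          intro iso[of "(p / b\<^sup>2) *s e1" "(1 / b) *s e2"])
          (simp_all add: Q_def coords field_simps power2_eq_square)
    next
      case False
      \<comment> \<open>The shift \<open>s\<close> removes the \<open>e1\<close> excess from the
        square of the second basis vector. If \<open>c = 0\<close>, then also \<open>p = 0\<close>,
        and division by zero gives the suitable value \<open>s = 0\<close>.\<close>
      define s where "s = - (p / (b * c))"
      have s: "s * (b * c) = - p" using False E by (auto simp: s_def)
      have "p = - (s * (b * c))" by (simp add: s)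
      then show ?thesis using E
        by (intro exI[of _ "N06 (c / b)"], unfold nov_zero_dot.simps,
          intro iso[of e1 "s *s e1 + (1 / b) *s e2"])
          (simp_all add: Q_def coords field_simps power2_eq_square)
    qed
  qed
qed

lemma classify_zero_dot:
  fixes Q :: "complex ^ 2 \<Rightarrow> complex ^ 2 \<Rightarrow> complex ^ 2"
  assumes np: "novikov_poisson_algebra (*s) (\<lambda>_ _. 0) Q" and nonzero: "Q x y \<noteq> 0"
  shows "\<exists>A. np_isomorphic (*s) (\<lambda>_ _. 0) Q (*s) (\<lambda>_ _. 0) (nov_zero_dot A)"
proof -
  interpret plane_np_algebra "\<lambda>_ _. 0" Q by (rule plane_np_algebra.intro) fact
  obtain u where u: "u \<noteq> 0" "\<And>x. \<exists>k. Q u x = k *s u" using nov_common_eigenvector by blast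
  obtain v where v: "det2 u v \<noteq> 0" using det2_complement[OF u(1)] .
  obtain a b where ab: "Q u u = a *s u" "Q u v = b *s u" using u(2) by metis
  obtain c d where cd: "Q v u = c *s u + d *s v" using det2_span[OF v] .
  obtain p q where pq: "Q v v = p *s u + q *s v" using det2_span[OF v] .
  let ?Q = "mult_table (a *s e1) (b *s e1) (c *s e1 + d *s e2) (p *s e1 + q *s e2)"
  have iso: "np_isomorphic (*s) (\<lambda>_ _. 0) Q (*s) (\<lambda>_ _. 0) ?Q"
    by (rule np_isomorphic_change_basis_zero_dot[OF nov_bilinear v])
      (simp_all add: ab cd pq axis_def)
  then obtain f where "\<And>x y. f (Q x y) = ?Q (f x) (f y)" "inj f" "f 0 = 0"
    unfolding np_isomorphic_def bij_def by metis
  then have "?Q (f x) (f y) \<noteq> 0" using nonzero by (metis injD)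
  from classify_triangular_zero_dot[OF novikov_poisson_transfer[OF np iso] this]
  show ?thesis using np_isomorphic_trans[OF iso] by blast
qed

subsection \<open>Algebras with nonzero commutative product\<close>

lemma np_isomorphic_refl:
  fixes P Q :: "complex ^ 2 \<Rightarrow> complex ^ 2 \<Rightarrow> complex ^ 2"
  shows "np_isomorphic (*s) P Q (*s) P Q"
  unfolding np_isomorphic_def Vector_Spaces.linear_iff
  by (intro exI[of _ id]) (simp add: vec.vector_space_axioms)

text \<open>As \<open>e1\<close> is idempotent and orthogonal to \<open>e2\<close>,
  \<open>dot_nov\<close> puts \<open>e1 \<circ> x\<close> in the span of \<open>e1\<close> and
  \<open>e2 \<circ> x\<close> in that of \<open>e2\<close>. Then \<open>nov_dot\<close> at
  \<open>e1, e2, e1\<close> equates a multiple of \<open>e1\<close> with one of \<open>e2\<close>,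
  so the mixed products vanish.\<close>

lemma nov_of_orthogonal_dot:
  assumes e: "e \<in> {0, e2}"
    and "novikov_poisson_algebra (*s) (mult_table e1 0 0 e) (mult_table a b c d)"
  shows "b = 0 \<and> c = 0 \<and> a $ 2 = 0 \<and> d $ 1 = 0"
proof -
  interpret novikov_poisson_algebra "(*s)" "mult_table e1 0 0 e" "mult_table a b c d" by fact
  show ?thesis
    using e dot_nov[of e1 e1 e1] dot_nov[of e1 e1 e2] dot_nov[of e1 e2 e1] dot_nov[of e1 e2 e2]
      nov_dot[of e1 e2 e1] nov_dot[of e1 e2 e2] dot_nov[of e2 e2 e1] dot_nov[of e2 e2 e2]
    by (auto simp add: coords)
qed

lemma classify_semisimple_dot:
  assumes "novikov_poisson_algebra (*s) (mult_table e1 0 0 e2) (mult_table a b c d)"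
  shows "\<exists>A. np_isomorphic (*s) (mult_table e1 0 0 e2) (mult_table a b c d)
    (*s) (dot_nonzero_dot A) (nov_nonzero_dot A)"
proof -
  have "mult_table a b c d = nov_nonzero_dot (N07 (a $ 1) (d $ 2))"
    using nov_of_orthogonal_dot[OF _ assms]
    by (intro ext) (simp add: coords)
  then show ?thesis by (intro exI[of _ "N07 (a $ 1) (d $ 2)"]) (simp add: np_isomorphic_refl)
qed

lemma classify_idempotent_dot:
  assumes "novikov_poisson_algebra (*s) (mult_table e1 0 0 0) (mult_table a b c d)"
  shows "\<exists>A. np_isomorphic (*s) (mult_table e1 0 0 0) (mult_table a b c d)
    (*s) (dot_nonzero_dot A) (nov_nonzero_dot A)"
proof -
  note eqs = nov_of_orthogonal_dot[OF _ assms]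
  show ?thesis
  proof (cases "d $ 2 = 0")
    case True
    then have "mult_table a b c d = nov_nonzero_dot (N11 (a $ 1))"
      using eqs by (intro ext) (simp add: coords)
    then show ?thesis by (intro exI[of _ "N11 (a $ 1)"]) (simp add: np_isomorphic_refl)
  next
    case False
    then show ?thesis using eqs
      by (intro exI[of _ "N10 (a $ 1)"], unfold dot_nonzero_dot.simps nov_nonzero_dot.simps,
        intro np_isomorphic_change_basis[of _ _ e1 "(1 / d $ 2) *s e2"])
        (simp_all add: bilinear_product_mult_table coords)
  qed
qed

text \<open>Since \<open>e1\<close> is the unit, \<open>dot_nov\<close> gives
  \<open>e2 \<circ> x = e2 \<cdot> (e1 \<circ> x)\<close>, and \<open>nov_dot\<close> forces
  \<open>e2 \<circ> e2 = 0\<close>. Rescaling \<open>e2\<close> turns a nonzero \<open>a $ 2\<close>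
  into 1.\<close>

lemma classify_dual_number_dot:
  assumes "novikov_poisson_algebra (*s) (mult_table e1 e2 e2 0) (mult_table a b c d)"
  shows "\<exists>A. np_isomorphic (*s) (mult_table e1 e2 e2 0) (mult_table a b c d)
    (*s) (dot_nonzero_dot A) (nov_nonzero_dot A)"
proof -
  interpret novikov_poisson_algebra "(*s)" "mult_table e1 e2 e2 0" "mult_table a b c d" by fact
  have eqs: "b $ 1 = 0" "c $ 1 = 0" "c $ 2 = a $ 1" "d $ 1 = 0" "d $ 2 = 0"
    using dot_nov[of e2 e1 e1] dot_nov[of e2 e1 e2] nov_dot[of e1 e2 e2]
    by (auto simp add: coords)
  show ?thesis
  proof (cases "a $ 2 = 0")
    case True
    then have "mult_table a b c d = nov_nonzero_dot (N09 (a $ 1) (b $ 2))"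
      using eqs by (intro ext) (simp add: coords)
    then show ?thesis by (intro exI[of _ "N09 (a $ 1) (b $ 2)"]) (simp add: np_isomorphic_refl)
  next
    case False
    then show ?thesis using eqs
      by (intro exI[of _ "N08 (a $ 1) (b $ 2)"], unfold dot_nonzero_dot.simps nov_nonzero_dot.simps,
        intro np_isomorphic_change_basis[of _ _ e1 "(a $ 2) *s e2"])
        (simp_all add: bilinear_product_mult_table coords)
  qed
qed

text \<open>Bases preserving \<cdot> have the form \<open>t e1 + s e2\<close>,
  \<open>t t e2\<close>. The scale \<open>t\<close> normalises the first nonzero one of
  \<open>b $ 2\<close> and \<open>a $ 1\<close>; if \<open>b $ 2\<close> is nonzero,
  \<open>s\<close> also clears the \<open>e2\<close> part of \<open>e1 \<circ> e1\<close>.\<close>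

lemma classify_nilpotent_dot:
  assumes "novikov_poisson_algebra (*s) (mult_table e2 0 0 0) (mult_table a b c d)"
  shows "\<exists>A. np_isomorphic (*s) (mult_table e2 0 0 0) (mult_table a b c d)
    (*s) (dot_nonzero_dot A) (nov_nonzero_dot A)"
proof -
  interpret novikov_poisson_algebra "(*s)" "mult_table e2 0 0 0" "mult_table a b c d" by fact
  have eqs: "b $ 1 = 0" "c $ 1 = 0" "c $ 2 = a $ 1" "d $ 1 = 0" "d $ 2 = 0"
    using dot_nov[of e1 e1 e1] dot_nov[of e1 e1 e2] nov_dot[of e1 e2 e1]
    by (auto simp add: coords)
  consider "b $ 2 \<noteq> 0" | "b $ 2 = 0" "a $ 1 \<noteq> 0" | "b $ 2 = 0" "a $ 1 = 0" by blast
  then show ?thesis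
  proof cases
    case 1
    define t where "t = 1 / b $ 2"
    have t: "b $ 2 = 1 / t" "t \<noteq> 0" using 1 by (simp_all add: t_def)
    show ?thesis using eqs t
      by (intro exI[of _ "N12 (a $ 1 * t)"], unfold dot_nonzero_dot.simps nov_nonzero_dot.simps,
        intro np_isomorphic_change_basis[of _ _ "t *s e1 - (a $ 2 * t\<^sup>2) *s e2" "t\<^sup>2 *s e2"])
        (simp_all add: bilinear_product_mult_table coords field_simps power2_eq_square)
  next
    case 2
    define t where "t = 1 / a $ 1"
    have t: "a $ 1 = 1 / t" "t \<noteq> 0" using 2 by (simp_all add: t_def)
    show ?thesis using eqs t 2(1)
      by (intro exI[of _ "N13 (a $ 2)"], unfold dot_nonzero_dot.simps nov_nonzero_dot.simps,
        intro np_isomorphic_change_basis[of _ _ "t *s e1" "t\<^sup>2 *s e2"])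
        (simp_all add: bilinear_product_mult_table coords field_simps power2_eq_square)
  next
    case 3
    then have "mult_table a b c d = nov_nonzero_dot (N14 (a $ 2))"
      using eqs by (intro ext) (simp add: coords)
    then show ?thesis by (intro exI[of _ "N14 (a $ 2)"]) (simp add: np_isomorphic_refl)
  qed
qed

lemma classify_nonzero_dot:
  fixes P Q :: "complex ^ 2 \<Rightarrow> complex ^ 2 \<Rightarrow> complex ^ 2"
  assumes np: "novikov_poisson_algebra (*s) P Q" and nonzero: "P x y \<noteq> 0"
  shows "\<exists>A. np_isomorphic (*s) P Q (*s) (dot_nonzero_dot A) (nov_nonzero_dot A)"
proof -
  interpret plane_np_algebra P Q by (rule plane_np_algebra.intro) fact
  obtain u v a b c where abc: "(a, b, c) \<in> {(e1, 0, e2), (e1, e2, 0), (e1, 0, 0), (e2, 0, 0)}"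
    and uv: "det2 u v \<noteq> 0" "P u u = (a $ 1) *s u + (a $ 2) *s v"
      "P u v = (b $ 1) *s u + (b $ 2) *s v" "P v v = (c $ 1) *s u + (c $ 2) *s v"
    using dot_basis[OF nonzero] by metis
  have "P v u = (b $ 1) *s u + (b $ 2) *s v" using uv dot_commute by simp
  then obtain a' b' c' d' where iso:
    "np_isomorphic (*s) P Q (*s) (mult_table a b b c) (mult_table a' b' c' d')"
    using np_isomorphic_change_dot[OF dot_bilinear nov_bilinear uv(1-3) _ uv(4)] by blast
  have "\<exists>A. np_isomorphic (*s) (mult_table a b b c) (mult_table a' b' c' d')
      (*s) (dot_nonzero_dot A) (nov_nonzero_dot A)"
    using abc novikov_poisson_transfer[OF np iso] classify_semisimple_dot
      classify_idempotent_dot classify_dual_number_dot classify_nilpotent_dot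
    by auto
  then show ?thesis using np_isomorphic_trans[OF iso] by blast
qed

subsection \<open>Non-isomorphic normal forms\<close>

text \<open>The converse of the change of basis: the images \<open>u\<close>, \<open>v\<close> of
  \<open>e1\<close>, \<open>e2\<close> satisfy the source table inside the target.\<close>

lemma np_isomorphic_mult_tableE:
  assumes "np_isomorphic (*s) (mult_table a b c d) (mult_table a' b' c' d') (*s) P Q"
  obtains u v where "det2 u v \<noteq> 0"
    "P u u = (a $ 1) *s u + (a $ 2) *s v" "P u v = (b $ 1) *s u + (b $ 2) *s v"
    "P v u = (c $ 1) *s u + (c $ 2) *s v" "P v v = (d $ 1) *s u + (d $ 2) *s v"
    "Q u u = (a' $ 1) *s u + (a' $ 2) *s v" "Q u v = (b' $ 1) *s u + (b' $ 2) *s v"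
    "Q v u = (c' $ 1) *s u + (c' $ 2) *s v" "Q v v = (d' $ 1) *s u + (d' $ 2) *s v"
proof -
  obtain f :: "complex ^ 2 \<Rightarrow> complex ^ 2" where lin: "Vector_Spaces.linear (*s) (*s) f" and "bij f"
    and f: "\<And>x y. f (mult_table a b c d x y) = P (f x) (f y)"
      "\<And>x y. f (mult_table a' b' c' d' x y) = Q (f x) (f y)"
    using assms unfolding np_isomorphic_def by blast
  interpret f: Vector_Spaces.linear "(*s)" "(*s)" f by fact
  have f_eq: "f x = (x $ 1) *s f e1 + (x $ 2) *s f e2" for x
  proof -
    have "x = (x $ 1) *s e1 + (x $ 2) *s e2" by (simp add: vec_eq_iff forall_2 axis_def)
    then show ?thesis by (metis f.add f.scale)
  qed
  have inj: "f x = f 0 \<Longrightarrow> x = 0" for x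
    using \<open>bij f\<close> by (metis bij_def injD)
  have "det2 (f e1) (f e2) \<noteq> 0"
  proof
    assume 0: "det2 (f e1) (f e2) = 0"
    have "f e1 \<noteq> 0" using inj[of e1] by (auto simp: f.zero axis_eq_0_iff)
    then obtain k where "f e2 = k *s f e1" using 0 det2_eq_0_iff by blast
    then have "f (e2 - k *s e1) = f 0" by (simp add: f.diff f.scale f.zero)
    then have "e2 - k *s e1 = 0" by (rule inj)
    then show False by (simp add: vec_eq_iff forall_2 axis_def)
  qed
  moreover have "P (f e1) (f e1) = f a" "P (f e1) (f e2) = f b" "P (f e2) (f e1) = f c"
    "P (f e2) (f e2) = f d" "Q (f e1) (f e1) = f a'" "Q (f e1) (f e2) = f b'"
    "Q (f e2) (f e1) = f c'" "Q (f e2) (f e2) = f d'"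
    by (simp_all add: mult_table_basis flip: f)
  ultimately show ?thesis
    using that[of "f e1" "f e2"] unfolding f_eq[of a] f_eq[of b] f_eq[of c] f_eq[of d]
      f_eq[of a'] f_eq[of b'] f_eq[of c'] f_eq[of d'] by blast
qed

lemma np_isomorphic_N07_swap:
  "np_isomorphic (*s) (dot_nonzero_dot (N07 \<alpha> \<beta>)) (nov_nonzero_dot (N07 \<alpha> \<beta>))
     (*s) (dot_nonzero_dot (N07 \<beta> \<alpha>)) (nov_nonzero_dot (N07 \<beta> \<alpha>))"
  unfolding dot_nonzero_dot.simps nov_nonzero_dot.simps
  by (rule np_isomorphic_change_basis[of _ _ e2 e1])
    (simp_all add: bilinear_product_mult_table coords)

text \<open>Of the sixteen pairs of forms, the equal ones contradict the negated goal. For the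
  others the coordinate equations contradict \<open>det2 u v \<noteq> 0\<close>.\<close>

lemma dot_normal_form_unique:
  fixes u v :: "complex^2"
  assumes D: "(a, b, c) \<in> {(e1, 0, e2), (e1, e2, 0), (e1, 0, 0), (e2, 0, 0)}"
    "(a', b', c') \<in> {(e1, 0, e2), (e1, e2, 0), (e1, 0, 0), (e2, 0, 0)}"
    and eqs: "det2 u v \<noteq> 0"
    "mult_table a' b' b' c' u u = (a $ 1) *s u + (a $ 2) *s v"
    "mult_table a' b' b' c' u v = (b $ 1) *s u + (b $ 2) *s v"
    "mult_table a' b' b' c' v v = (c $ 1) *s u + (c $ 2) *s v"
  shows "a = a' \<and> b = b' \<and> c = c'"
proof (rule ccontr)
  assume "\<not> ?thesis"
  with D eqs show False
    apply (elim insertE emptyE)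
                   apply (simp_all only: prod.inject simp_thms)
               apply ((thin_tac "a = _ \<and> _", thin_tac "a' = _ \<and> _", simp add: coords, auto?)[1])+
    done
qed

text \<open>This and the next three lemmas find the automorphisms of the four commutative algebras.
  Here two nonzero orthogonal idempotents must be \<open>e1\<close> and \<open>e2\<close> in some
  order.\<close>

lemma semisimple_dot_basis:
  assumes "det2 u v \<noteq> 0" "mult_table e1 0 0 e2 u u = u" "mult_table e1 0 0 e2 u v = 0"
    "mult_table e1 0 0 e2 v v = v"
  shows "u = e1 \<and> v = e2 \<or> u = e2 \<and> v = e1"
  using assms by (simp add: coords; auto)

lemma dual_number_dot_basis:
  assumes "det2 u v \<noteq> 0" "mult_table e1 e2 e2 0 u u = u" "mult_table e1 e2 e2 0 u v = v"
    "mult_table e1 e2 e2 0 v v = 0"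
  shows "u = e1 \<and> v = v $ 2 *s e2 \<and> v $ 2 \<noteq> 0"
  using assms by (simp add: coords; auto)

lemma idempotent_dot_basis:
  assumes "det2 u v \<noteq> 0" "mult_table e1 0 0 0 u u = u" "mult_table e1 0 0 0 u v = 0"
    "mult_table e1 0 0 0 v v = 0"
  shows "u = e1 \<and> v = v $ 2 *s e2 \<and> v $ 2 \<noteq> 0"
  using assms by (simp add: coords; auto)

lemma nilpotent_dot_basis:
  assumes "det2 u v \<noteq> 0" "mult_table e2 0 0 0 u u = v" "mult_table e2 0 0 0 u v = 0"
    "mult_table e2 0 0 0 v v = 0"
  shows "u $ 1 \<noteq> 0 \<and> v = (u $ 1)\<^sup>2 *s e2"
  using assms by (simp add: coords power2_eq_square; auto)

lemma mult_table_eq_iff: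
  "mult_table a b c d = mult_table a' b' c' d' \<longleftrightarrow> a = a' \<and> b = b' \<and> c = c' \<and> d = d'"
  by (metis mult_table_basis)

text \<open>Forgetting \<circ> leaves an isomorphism of the commutative products, whose normal form
  is unique. Hence only automorphisms of one fixed \<cdot> remain to be examined.\<close>

lemma dot_nonzero_dot_eq:
  assumes "np_isomorphic (*s) (dot_nonzero_dot A) (nov_nonzero_dot A)
    (*s) (dot_nonzero_dot B) (nov_nonzero_dot B)"
  shows "dot_nonzero_dot A = dot_nonzero_dot B"
proof -
  have form: "\<exists>a b c. dot_nonzero_dot A = mult_table a b b c \<and>
      (a, b, c) \<in> {(e1, 0, e2), (e1, e2, 0), (e1, 0, 0), (e2, 0, 0)}" for A
    by (cases A) (auto simp: mult_table_eq_iff)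
  obtain a b c a' b' c' where D: "dot_nonzero_dot A = mult_table a b b c"
      "dot_nonzero_dot B = mult_table a' b' b' c'"
      "(a, b, c) \<in> {(e1, 0, e2), (e1, e2, 0), (e1, 0, 0), (e2, 0, 0)}"
      "(a', b', c') \<in> {(e1, 0, e2), (e1, e2, 0), (e1, 0, 0), (e2, 0, 0)}"
    using form[of A] form[of B] by metis
  obtain x y z w where "nov_nonzero_dot A = mult_table x y z w" by (cases A; simp add: mult_table_eq_iff)
  then have "np_isomorphic (*s) (mult_table a b b c) (mult_table x y z w)
    (*s) (mult_table a' b' b' c') (nov_nonzero_dot B)"
    using assms D by simp
  then have "a = a' \<and> b = b' \<and> c = c'"
    by (rule np_isomorphic_mult_tableE) (rule dot_normal_form_unique[OF D(3,4)])
  then show ?thesis using D(1,2) by simp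
qed

lemma isomorphic_semisimple_dot:
  assumes "np_isomorphic (*s) (mult_table e1 0 0 e2) (mult_table (a *s e1) 0 0 (b *s e2))
    (*s) (mult_table e1 0 0 e2) (mult_table (a' *s e1) 0 0 (b' *s e2))"
  shows "a = a' \<and> b = b' \<or> a = b' \<and> b = a'"
proof -
  obtain u v where "det2 u v \<noteq> 0"
    "mult_table e1 0 0 e2 u u = u" "mult_table e1 0 0 e2 u v = 0" "mult_table e1 0 0 e2 v v = v"
    and Q: "mult_table (a' *s e1) 0 0 (b' *s e2) u u = a *s u"
    "mult_table (a' *s e1) 0 0 (b' *s e2) v v = b *s v"
    using assms by (rule np_isomorphic_mult_tableE) (simp add: axis_def)
  then have "u = e1 \<and> v = e2 \<or> u = e2 \<and> v = e1" using semisimple_dot_basis by blast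
  then show ?thesis using Q by (elim disjE conjE) (simp_all add: mult_table_def axis_def vec_eq_iff forall_2)
qed

text \<open>The isomorphism fixes \<open>e1\<close> and scales \<open>e2\<close> by
  \<open>k\<close>. So \<open>a $ 1\<close> and \<open>b $ 2\<close> are invariants, while of
  \<open>a $ 2\<close> and \<open>d $ 2\<close> only the vanishing is invariant.\<close>

lemma isomorphic_idempotent_dot:
  assumes "e \<in> {0, e2}" "np_isomorphic (*s) (mult_table e1 e e 0) (mult_table a b c d)
    (*s) (mult_table e1 e e 0) (mult_table a' b' c' d')"
  shows "\<exists>k. k \<noteq> 0 \<and> a' $ 1 = a $ 1 \<and> a' $ 2 = k * a $ 2 \<and> b' $ 2 = b $ 2 \<and> k * d' $ 2 = d $ 2"
proof -
  obtain u v where *: "det2 u v \<noteq> 0"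
    "mult_table e1 e e 0 u u = u" "mult_table e1 e e 0 u v = (e $ 1) *s u + (e $ 2) *s v" "mult_table e1 e e 0 v v = 0"
    and Q: "mult_table a' b' c' d' u u = (a $ 1) *s u + (a $ 2) *s v"
    "mult_table a' b' c' d' u v = (b $ 1) *s u + (b $ 2) *s v"
    "mult_table a' b' c' d' v v = (d $ 1) *s u + (d $ 2) *s v"
    using assms(2) by (rule np_isomorphic_mult_tableE) (simp add: axis_def)
  consider "e = 0" | "e = e2" using assms(1) by blast
  then have "u = e1 \<and> v = v $ 2 *s e2 \<and> v $ 2 \<noteq> 0"
  proof cases
    case 1
    then show ?thesis using * by (intro idempotent_dot_basis) simp_all
  next
    case 2
    then show ?thesis using * by (intro dual_number_dot_basis) (simp_all add: axis_def)
  qed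
  then obtain k where uv: "u = e1" "v = k *s e2" "k \<noteq> 0" by metis
  then show ?thesis using Q by (intro exI[of _ k]) (simp add: mult_table_def vec_eq_iff forall_2 axis_def)
qed

text \<open>The numbers \<open>t\<close>, \<open>s\<close> are the coordinates of the image of
  \<open>e1\<close>, and \<open>e2\<close> goes to \<open>t t e2\<close>. Comparing coordinates of
  \<open>u \<circ> u\<close> and \<open>u \<circ> v\<close> gives the equations.\<close>

lemma isomorphic_nilpotent_dot:
  assumes "np_isomorphic (*s) (mult_table e2 0 0 0) (mult_table a b c d)
    (*s) (mult_table e2 0 0 0) (mult_table a' b' c' d')"
    and [simp]: "b' $ 1 = 0" "c' $ 1 = 0" "d' = 0"
  shows "\<exists>t s. t \<noteq> 0 \<and> t * a' $ 1 = a $ 1 \<and> t\<^sup>2 * a' $ 2 + t * s * (b' $ 2 + c' $ 2) = s * a $ 1 + t\<^sup>2 * a $ 2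
    \<and> t * b' $ 2 = b $ 2"
proof -
  obtain u v where *: "det2 u v \<noteq> 0"
    "mult_table e2 0 0 0 u u = v" "mult_table e2 0 0 0 u v = 0" "mult_table e2 0 0 0 v v = 0"
    and Q: "mult_table a' b' c' d' u u = (a $ 1) *s u + (a $ 2) *s v"
    "mult_table a' b' c' d' u v = (b $ 1) *s u + (b $ 2) *s v"
    using assms(1) by (rule np_isomorphic_mult_tableE) (simp add: axis_def)
  have uv: "u $ 1 \<noteq> 0" "v = (u $ 1)\<^sup>2 *s e2"
    using nilpotent_dot_basis[OF *] by auto
  have "(u $ 1)\<^sup>2 * (u $ 1 * b' $ 2) = (u $ 1)\<^sup>2 * b $ 2"
    using Q(2) uv by (simp add: mult_table_def vec_eq_iff forall_2 axis_def algebra_simps)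
  then have "u $ 1 * b' $ 2 = b $ 2" using uv(1) by simp
  then show ?thesis using Q uv by (intro exI[of _ "u $ 1"] exI[of _ "u $ 2"])
    (simp add: mult_table_def vec_eq_iff forall_2 axis_def power2_eq_square algebra_simps)
qed

text \<open>In the nilpotent families, \<open>t b' $ 2 = b $ 2\<close> separates \<open>N12\<close>
  and gives \<open>t = 1\<close> inside it. Inside \<open>N13\<close> the equation for
  \<open>a $ 1\<close> gives \<open>t = 1\<close> and the terms in \<open>s\<close> cancel; inside
  \<open>N14\<close> they vanish.\<close>

lemma nonzero_dot_isomorphic_imp:
  assumes "np_isomorphic (*s) (dot_nonzero_dot A) (nov_nonzero_dot A)
                          (*s) (dot_nonzero_dot B) (nov_nonzero_dot B)"
  shows "A = B \<or> (\<exists>\<alpha> \<beta>. A = N07 \<alpha> \<beta> \<and> B = N07 \<beta> \<alpha>)"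
proof -
  note un = isomorphic_idempotent_dot[of e2, simplified] isomorphic_idempotent_dot[of 0, simplified]
  note iso = assms dot_nonzero_dot_eq[OF assms]
  note [simp] = mult_table_eq_iff axis_eq_axis axis_eq_0_iff
  have [simp]: "e1 $ 1 = (1 :: complex)" "e1 $ 2 = (0 :: complex)"
    "e2 $ 1 = (0 :: complex)" "e2 $ 2 = (1 :: complex)"
    by (simp_all add: axis_def)
  show ?thesis
  proof (cases A)
    case (N07 x y)
    then show ?thesis using iso isomorphic_semisimple_dot by (cases B) auto
  next
    case (N08 x y)
    then show ?thesis using iso by (cases B) (auto dest!: un)
  next
    case (N09 x y)
    then show ?thesis using iso by (cases B) (auto dest!: un)
  next
    case (N10 x)
    then show ?thesis using iso by (cases B) (auto dest!: un)
  next
    case (N11 x)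
    then show ?thesis using iso by (cases B) (auto dest!: un)
  next
    case (N12 x)
    then show ?thesis using iso by (cases B) (auto dest!: isomorphic_nilpotent_dot)
  next
    case (N13 x)
    then show ?thesis using iso by (cases B) (auto dest!: isomorphic_nilpotent_dot)
  next
    case (N14 x)
    then show ?thesis using iso by (cases B) (auto dest!: isomorphic_nilpotent_dot)
  qed
qed

theorem theorem35:
  shows
    "(\<forall>(smul :: complex \<Rightarrow> 'v::ab_group_add \<Rightarrow> 'v) dot nov.
        novikov_poisson_algebra smul dot nov \<and>
        vector_space.dim smul UNIV = 2 \<and>
        \<not> ((\<forall>x y. dot x y = 0) \<and> (\<forall>x y. nov x y = 0)) \<longrightarrow>
        (\<exists>A. np_isomorphic smul dot nov (*s) (\<lambda>_ _. 0) (nov_zero_dot A)) \<or>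
        (\<exists>A. np_isomorphic smul dot nov (*s) (dot_nonzero_dot A) (nov_nonzero_dot A)))
     \<and>
     (\<forall>A B. np_isomorphic (*s) (dot_nonzero_dot A) (nov_nonzero_dot A)
                          (*s) (dot_nonzero_dot B) (nov_nonzero_dot B) \<longleftrightarrow>
        A = B \<or> (\<exists>\<alpha> \<beta>. A = N07 \<alpha> \<beta> \<and> B = N07 \<beta> \<alpha>))"
proof (intro conjI allI impI)
  fix smul :: "complex \<Rightarrow> 'v \<Rightarrow> 'v" and dot nov
  assume H: "novikov_poisson_algebra smul dot nov \<and> vector_space.dim smul UNIV = 2 \<and>
    \<not> ((\<forall>x y. dot x y = 0) \<and> (\<forall>x y. nov x y = 0))"
  then obtain a b c d a' b' c' d' where iso: "np_isomorphic smul dot nov (*s)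
      (mult_table a b c d) (mult_table a' b' c' d')" (is "np_isomorphic _ _ _ _ ?P ?Q")
    using np_isomorphic_mult_table by blast
  have np: "novikov_poisson_algebra (*s) ?P ?Q"
    using novikov_poisson_transfer iso H by blast
  show "(\<exists>A. np_isomorphic smul dot nov (*s) (\<lambda>_ _. 0) (nov_zero_dot A)) \<or>
    (\<exists>A. np_isomorphic smul dot nov (*s) (dot_nonzero_dot A) (nov_nonzero_dot A))"
  proof (cases "\<exists>x y. ?P x y \<noteq> 0")
    case True
    then show ?thesis using classify_nonzero_dot[OF np] np_isomorphic_trans[OF iso] by blast
  next
    case False
    then have P0: "?P = (\<lambda>_ _. 0)" by blast
    \<comment> \<open>By injectivity, two vanishing products on the plane would make both original
      products vanish.\<close>
    have "\<exists>x y. ?Q x y \<noteq> 0"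
    proof (rule ccontr)
      assume Q0: "\<not> ?thesis"
      obtain f where lin: "Vector_Spaces.linear smul (*s) f" and "bij f"
        and f: "\<And>x y. f (dot x y) = ?P (f x) (f y)" "\<And>x y. f (nov x y) = ?Q (f x) (f y)"
        using iso unfolding np_isomorphic_def by blast
      interpret f: Vector_Spaces.linear smul "(*s)" f by fact
      have "f (dot x y) = f 0" "f (nov x y) = f 0" for x y
        using Q0 False by (simp_all add: f f.zero)
      then have "dot x y = 0" "nov x y = 0" for x y
        using \<open>bij f\<close> by (metis bij_def injD)+
      then show False using H by blast
    qed
    then show ?thesis
      using classify_zero_dot[OF np[unfolded P0]] np_isomorphic_trans[OF iso[unfolded P0]] by blast
  qed
next
  fix A B
  show "np_isomorphic (*s) (dot_nonzero_dot A) (nov_nonzero_dot A)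
      (*s) (dot_nonzero_dot B) (nov_nonzero_dot B) \<longleftrightarrow>
    A = B \<or> (\<exists>\<alpha> \<beta>. A = N07 \<alpha> \<beta> \<and> B = N07 \<beta> \<alpha>)"
    using nonzero_dot_isomorphic_imp np_isomorphic_refl np_isomorphic_N07_swap by blast
qed

end
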